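(* Let $\Sigma$ be a finite alphabet, $d\ge 1$ and $n\ge 0$. Then $$\mathcal{I}_n=\bigcap_{k=n}^{\infty}\widetilde{\pi}_{k,n}(\mathcal{I}_k^{loc}).$$
   Context: $\Omega=\Sigma^{\mathbb{Z}^d}$ with the product topology and the shift action $(\Theta^u x)_v=x_{u+v}$ of $\mathbb{Z}^d$; $\mathcal{I}$ is the set of $\Theta$-invariant Borel probability measures on $\Omega$. $\Lambda_n=\{-n,\ldots,n\}^d$, $\Omega_n=\Sigma^{\Lambda_n}$, $\mathcal{P}_n$ is the set of probability measures on $\Omega_n$; $\pi_n$ denotes both the restriction map $\Omega\to\Omega_n$, $x\mapsto x|_{\Lambda_n}$, and the induced push-forward map on probability measures; $\mathcal{I}_n=\pi_n(\mathcal{I})$. For a finite set $E\subseteq\mathbb{Z}^d$, $a\in\Sigma^E$ and $u\in\mathbb{Z}^d$, the pattern $\Theta^u a\in\Sigma^{E-u}$ is defined by $(\Theta^u a)_v=a_{v+u}$. For $E\subseteq\Lambda_n$ and $a\in\Sigma^E$, $[a]_n=\{b\in\Omega_n : b|_E=a\}$. $\mathcal{I}_n^{loc}$ is the set of locally invariant measures, i.e. of $\mu\in\mathcal{P}_n$ such that $\mu([a]_n)=\mu([\Theta^u a]_n)$ for every $E\subseteq\Lambda_n$, every $a\in\Sigma^E$ and every $u\in\mathbb{Z}^d$ with $E-u\subseteq\Lambda_n$. For $k\ge n$, $\widetilde{\pi}_{k,n}:\mathcal{I}_k^{loc}\to\mathcal{I}_n^{loc}$ is the push-forward map induced by the restriction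 $\Omega_k\to\Omega_n$, $a\mapsto a|_{\Lambda_n}$ (the identity when $k=n$). *)

theory Defs
  imports "HOL-Probability.Probability"
begin

text \<open>
  The group is \<^typ>\<open>int ^ 'd\<close> and the alphabet is a finite discrete type, so that the full
  configuration space is the function type \<^typ>\<open>int ^ 'd \<Rightarrow> 'a\<close> with the library's product
  topology.  A pattern on a set \<open>E\<close> is an element of \<open>E \<rightarrow>\<^sub>E UNIV\<close>, i.e. it takes the value
  \<^const>\<open>undefined\<close> outside \<open>E\<close>.
\<close>

definition shift :: "int ^ 'd \<Rightarrow> (int ^ 'd \<Rightarrow> 'a) \<Rightarrow> (int ^ 'd \<Rightarrow> 'a)" where
  "shift u x = (\<lambda>v. x (u + v))"

definition cube :: "nat \<Rightarrow> (int ^ 'd) set" where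
  "cube n = {v. \<forall>i. - int n \<le> v $ i \<and> v $ i \<le> int n}"

definition patterns :: "(int ^ 'd) set \<Rightarrow> (int ^ 'd \<Rightarrow> 'a) set" where
  "patterns E = E \<rightarrow>\<^sub>E UNIV"

definition translate :: "(int ^ 'd) set \<Rightarrow> int ^ 'd \<Rightarrow> (int ^ 'd) set" where
  "translate E u = (\<lambda>v. v - u) ` E"

text \<open>The same function \<^const>\<open>shift\<close> also acts correctly on patterns.\<close>

lemma shift_patterns: "a \<in> patterns E \<Longrightarrow> shift u a \<in> patterns (translate E u)"
  by (force simp: patterns_def translate_def shift_def PiE_iff extensional_def image_iff
      algebra_simps)

definition invariant_measures ::
  "(int ^ 'd \<Rightarrow> 'a::{finite, discrete_topology}) measure set" where
  "invariant_measures =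
     {M. prob_space M \<and> sets M = sets borel \<and> (\<forall>u. distr M borel (shift u) = M)}"

definition prob_measures :: "nat \<Rightarrow> (int ^ 'd \<Rightarrow> 'a::finite) measure set" where
  "prob_measures n = {M. prob_space M \<and> sets M = sets (count_space (patterns (cube n)))}"

text \<open>
  Restriction to \<open>cube n\<close> is the same function on full configurations and on patterns on a larger
  cube, so this single push-forward serves for both.
\<close>

definition marginal ::
  "nat \<Rightarrow> (int ^ 'd \<Rightarrow> 'a::finite) measure \<Rightarrow> (int ^ 'd \<Rightarrow> 'a) measure" where
  "marginal n M = distr M (count_space (patterns (cube n))) (\<lambda>x. restrict x (cube n))"

definition cylinder ::
  "nat \<Rightarrow> (int ^ 'd) set \<Rightarrow> (int ^ 'd \<Rightarrow> 'a) \<Rightarrow> (int ^ 'd \<Rightarrow> 'a) set" where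
  "cylinder n E a = {b \<in> patterns (cube n). restrict b E = a}"

definition locally_invariant_measures :: "nat \<Rightarrow> (int ^ 'd \<Rightarrow> 'a::finite) measure set" where
  "locally_invariant_measures n =
     {M \<in> prob_measures n.
        \<forall>E a u. E \<subseteq> cube n \<longrightarrow> a \<in> patterns E \<longrightarrow> translate E u \<subseteq> cube n \<longrightarrow>
          measure M (cylinder n E a) = measure M (cylinder n (translate E u) (shift u a))}"

text \<open>
  The measurability side conditions of the two uses of \<^const>\<open>distr\<close> on the full configuration
  space hold.
\<close>

lemma shift_measurable:
  "shift u \<in> borel_measurable (borel :: (int ^ 'd \<Rightarrow> 'a::discrete_topology) measure)"
  unfolding shift_def
  by (intro borel_measurable_continuous_onI continuous_on_coordinatewise_then_product
      continuous_on_product_coordinates)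

lemma finite_cube: "finite (cube n :: (int ^ 'd) set)"
proof -
  have "cube n \<subseteq> vec_lambda ` (UNIV \<rightarrow>\<^sub>E {- int n..int n} :: ('d \<Rightarrow> int) set)"
  proof
    fix v :: "int ^ 'd" assume "v \<in> cube n"
    then have "vec_nth v \<in> UNIV \<rightarrow>\<^sub>E {- int n..int n}"
      by (auto simp: cube_def)
    then show "v \<in> vec_lambda ` (UNIV \<rightarrow>\<^sub>E {- int n..int n})"
      by (metis image_eqI vec_nth_inverse)
  qed
  moreover have "finite (UNIV \<rightarrow>\<^sub>E {- int n..int n} :: ('d \<Rightarrow> int) set)"
    by (intro finite_PiE) auto
  ultimately show ?thesis
    by (meson finite_imageI finite_subset)
qed

lemma restrict_measurable:
  "(\<lambda>x. restrict x (cube n)) \<in>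
     (borel :: (int ^ 'd \<Rightarrow> 'a::{finite, discrete_topology}) measure)
       \<rightarrow>\<^sub>M count_space (patterns (cube n))"
proof -
  have fin: "finite (patterns (cube n) :: (int ^ 'd \<Rightarrow> 'a) set)"
    unfolding patterns_def by (intro finite_PiE finite_cube) auto
  have "(\<lambda>x. restrict x (cube n)) -` {a} \<inter> space borel
      \<in> sets (borel :: (int ^ 'd \<Rightarrow> 'a) measure)" if a: "a \<in> patterns (cube n)" for a
  proof -
    have "(\<lambda>x. restrict x (cube n)) -` {a} = (\<Inter>v\<in>cube n. (\<lambda>x. x v) -` {a v})"
      using a by (auto simp: patterns_def PiE_def extensional_def fun_eq_iff restrict_def)
    moreover have "open (\<Inter>v\<in>cube n. (\<lambda>x::int ^ 'd \<Rightarrow> 'a. x v) -` {a v})"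
    proof (intro open_INT finite_cube ballI)
      fix v :: "int ^ 'd"
      show "open ((\<lambda>x::int ^ 'd \<Rightarrow> 'a. x v) -` {a v})"
        by (rule open_vimage[OF Topological_Spaces.open_discrete
              continuous_on_product_coordinates])
    qed
    ultimately show ?thesis
      by simp
  qed
  then show ?thesis
    using fin by (auto simp: measurable_count_space_eq2 patterns_def)
qed

end

theory Submission imports Defs begin

text \<open>
  The marginal of an invariant measure on any larger cube is locally invariant, which gives one
  inclusion.  For the other, let \<open>\<nu>\<^sub>k\<close> be locally invariant on a cube of size at least \<open>k\<close>, all with
  the same marginal on the cube of size \<open>n\<close>.  The set functions \<open>A \<mapsto> \<nu>\<^sub>k (A \<inter> patterns)\<close>, defined
  on all sets of configurations, lie in a compact product of unit intervals and so have a
  cluster point.  It is finitely additive, and on events depending on finitely many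
  coordinates it is shift-invariant.  These events are clopen and the configuration space is
  compact, so the cluster point is automatically countably additive on them, and
  Caratheodory's theorem extends it to an invariant Borel measure.
\<close>

text \<open>
  A cluster point suffices for passing closed conditions to the limit; no convergent subsequence
  is needed, and the index type may be uncountable.
\<close>

lemma cluster_point_in_unit_cube:
  fixes f :: "nat \<Rightarrow> 'i \<Rightarrow> real"
  assumes "\<And>k i. f k i \<in> {0..1}"
  shows "\<exists>g. \<forall>C. closed C \<longrightarrow> eventually (\<lambda>k. f k \<in> C) sequentially \<longrightarrow> g \<in> C"
proof -
  have "compactin (product_topology (\<lambda>i::'i. euclidean :: real topology) UNIV) (PiE UNIV (\<lambda>_. {0..1}))"
    by (subst compactin_PiE) auto
  then have "compact (PiE UNIV (\<lambda>_. {0..1}) :: ('i \<Rightarrow> real) set)"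
    by (simp add: euclidean_product_topology)
  moreover have "filtermap f sequentially \<noteq> bot"
    by (simp add: filtermap_bot_iff)
  moreover have "eventually (\<lambda>x. x \<in> PiE UNIV (\<lambda>_. {0..1})) (filtermap f sequentially)"
    using assms by (auto simp: eventually_filtermap PiE_def)
  ultimately obtain g where g: "inf (nhds g) (filtermap f sequentially) \<noteq> bot"
    unfolding compact_filter by blast
  show ?thesis
  proof (intro exI allI impI)
    fix C assume C: "closed C" "eventually (\<lambda>k. f k \<in> C) sequentially"
    show "g \<in> C"
    proof (rule ccontr)
      assume "g \<notin> C"
      then have "eventually (\<lambda>x. x \<in> - C) (nhds g)"
        using C(1) by (intro eventually_nhds_in_open) auto
      moreover have "eventually (\<lambda>x. x \<in> C) (filtermap f sequentially)"
        using C(2) by (simp add: eventually_filtermap)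
      ultimately have "eventually (\<lambda>_. False) (inf (nhds g) (filtermap f sequentially))"
        unfolding eventually_inf by blast
      then show False
        using g by (simp add: trivial_limit_def)
    qed
  qed
qed

section \<open>Cubes and finite sets of sites\<close>

lemma cube_mono: "m \<le> n \<Longrightarrow> cube m \<subseteq> cube n"
  unfolding cube_def by (intro Collect_mono) (meson neg_le_iff_le of_nat_mono order_trans)

lemma finite_subset_cube:
  fixes I :: "(int ^ 'd) set"
  assumes "finite I"
  shows "\<exists>m. I \<subseteq> cube m"
  using assms
proof induction
  case (insert v I)
  then obtain m where "I \<subseteq> cube m"
    by auto
  \<comment> \<open>The sum of the absolute values of all coordinates of \<open>v\<close> is a crude
    but sufficient bound for each single one.\<close>
  define r where "r = (\<Sum>i\<in>UNIV. nat \<bar>v $ i\<bar>)"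
  have "nat \<bar>v $ i\<bar> \<le> r" for i
    unfolding r_def by (rule member_le_sum) auto
  then have "\<bar>v $ i\<bar> \<le> int r" for i
    by (simp add: nat_le_iff)
  then have "v \<in> cube r"
    by (auto simp: cube_def abs_le_iff minus_le_iff)
  then have "insert v I \<subseteq> cube (max m r)"
    using \<open>I \<subseteq> cube m\<close> cube_mono[of m "max m r"] cube_mono[of r "max m r"] by auto
  then show ?case ..
qed simp

lemma finite_patterns: "finite E \<Longrightarrow> finite (patterns E :: (int ^ 'd \<Rightarrow> 'a::finite) set)"
  unfolding patterns_def by (intro finite_PiE) auto

lemma restrict_in_patterns [simp]: "restrict x E \<in> patterns E"
  by (simp add: patterns_def)

section \<open>The algebra of events determined by finitely many coordinates\<close>

text \<open>Agreement on a cube is a symmetric relation, so an implication in one direction already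
  says that membership depends only on the coordinates in the cube. Every finite set of sites lies
  in some cube, so nothing is lost by letting only cubes serve as windows.\<close>

definition local_events :: "(int ^ 'd \<Rightarrow> 'a) set set" where
  "local_events = {A. \<exists>m. \<forall>x y. (\<forall>v\<in>cube m. x v = y v) \<longrightarrow> x \<in> A \<longrightarrow> y \<in> A}"

lemma local_eventsI:
  assumes "finite I" "\<And>x y. (\<And>v. v \<in> I \<Longrightarrow> x v = y v) \<Longrightarrow> x \<in> A \<Longrightarrow> y \<in> A"
  shows "A \<in> local_events"
proof -
  obtain m where "I \<subseteq> cube m"
    using finite_subset_cube[OF assms(1)] by blast
  then show ?thesis
    unfolding local_events_def using assms(2) by blast
qed

lemma local_eventsD:
  assumes "A \<in> local_events"
  shows "\<exists>m. \<forall>x y. (\<forall>v\<in>cube m. x v = y v) \<longrightarrow> (x \<in> A \<longleftrightarrow> y \<in> A)"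
proof -
  obtain m where m: "\<And>x y. (\<forall>v\<in>cube m. x v = y v) \<Longrightarrow> x \<in> A \<Longrightarrow> y \<in> A"
    using assms unfolding local_events_def by blast
  have "x \<in> A \<longleftrightarrow> y \<in> A" if "\<forall>v\<in>cube m. x v = y v" for x y
    using m[of x y] m[of y x] that by auto
  then show ?thesis
    by blast
qed

lemma local_events_Compl: "A \<in> local_events \<Longrightarrow> - A \<in> local_events"
  by (drule local_eventsD, erule exE, rule local_eventsI[OF finite_cube]) blast

lemma local_events_Un:
  assumes "A \<in> local_events" "B \<in> local_events"
  shows "A \<union> B \<in> local_events"
proof -
  obtain m where m: "\<And>x y. \<forall>v\<in>cube m. x v = y v \<Longrightarrow> x \<in> A \<longleftrightarrow> y \<in> A"
    using local_eventsD[OF assms(1)] by blast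
  obtain k where k: "\<And>x y. \<forall>v\<in>cube k. x v = y v \<Longrightarrow> x \<in> B \<longleftrightarrow> y \<in> B"
    using local_eventsD[OF assms(2)] by blast
  show ?thesis
  proof (rule local_eventsI[of "cube m \<union> cube k"])
    fix x y assume "\<And>v. v \<in> cube m \<union> cube k \<Longrightarrow> x v = y v" "x \<in> A \<union> B"
    then show "y \<in> A \<union> B"
      using m[of x y] k[of x y] by blast
  qed (simp add: finite_cube)
qed

lemma algebra_local_events: "algebra UNIV local_events"
  unfolding algebra_iff_Un
proof (intro conjI ballI)
  show "{} \<in> local_events"
    by (rule local_eventsI[of "{}"]) auto
qed (use local_events_Compl local_events_Un in \<open>auto simp: Compl_eq_Diff_UNIV\<close>)

lemma shift_vimage_local_events:
  assumes "A \<in> local_events"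
  shows "shift u -` A \<in> local_events"
proof -
  obtain m where m: "\<And>x y. \<forall>v\<in>cube m. x v = y v \<Longrightarrow> x \<in> A \<longleftrightarrow> y \<in> A"
    using local_eventsD[OF assms] by blast
  show ?thesis
  proof (rule local_eventsI[of "(+) u ` cube m"])
    fix x y assume "\<And>v. v \<in> (+) u ` cube m \<Longrightarrow> x v = y v" "x \<in> shift u -` A"
    then show "y \<in> shift u -` A"
      using m[of "shift u x" "shift u y"] by (auto simp: shift_def)
  qed (simp add: finite_cube)
qed

lemma restrict_eq_local_event: "finite E \<Longrightarrow> {x. restrict x E = a} \<in> local_events"
  by (rule local_eventsI[of E]) (auto cong: restrict_cong)

section \<open>Local events in the topology and the Borel sets\<close>

lemma open_agreement:
  fixes x :: "int ^ 'd \<Rightarrow> 'a::discrete_topology"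
  assumes "finite I"
  shows "open {y. \<forall>v\<in>I. y v = x v}"
  using product_topology_basis'[OF assms, of "\<lambda>v. {x v}" "\<lambda>v. v"]
  by (simp add: Topological_Spaces.open_discrete)

lemma local_events_open:
  fixes A :: "(int ^ 'd \<Rightarrow> 'a::discrete_topology) set"
  assumes "A \<in> local_events"
  shows "open A"
proof -
  obtain m where m: "\<And>x y. \<forall>v\<in>cube m. x v = y v \<Longrightarrow> x \<in> A \<longleftrightarrow> y \<in> A"
    using local_eventsD[OF assms] by blast
  show ?thesis
  proof (subst open_subopen, intro ballI exI conjI)
    fix x assume "x \<in> A"
    then show "{y. \<forall>v\<in>cube m. y v = x v} \<subseteq> A"
      using m by blast
  qed (auto intro: open_agreement finite_cube)
qed

lemma local_events_closed:
  fixes A :: "(int ^ 'd \<Rightarrow> 'a::discrete_topology) set"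
  shows "A \<in> local_events \<Longrightarrow> closed A"
  using local_events_open[OF local_events_Compl] by (simp add: closed_def)

text \<open>Every open set is the union of the cylinders that it contains. A cylinder is given by a
  cube and a pattern on it; the alphabet is finite, so there are only countably many of them and the
  union is countable.\<close>

lemma sigma_sets_local_events:
  "sigma_sets UNIV local_events = sets (borel :: (int ^ 'd \<Rightarrow> 'a::{finite, discrete_topology}) measure)"
proof
  show "sigma_sets UNIV local_events \<subseteq> sets (borel :: (int ^ 'd \<Rightarrow> 'a) measure)"
    using sets.sigma_sets_subset[of local_events "borel :: (int ^ 'd \<Rightarrow> 'a) measure"]
      borel_open[OF local_events_open] by (auto simp: subset_iff)
  have "U \<in> sigma_sets UNIV local_events" if "open U" for U :: "(int ^ 'd \<Rightarrow> 'a) set"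
  proof -
    define R where "R m a = {x :: int ^ 'd \<Rightarrow> 'a. restrict x (cube m) = a}" for m a
    \<comment> \<open>\<open>K\<close> indexes the cylinders contained in \<open>U\<close>.\<close>
    define K where "K = {(m, a). a \<in> patterns (cube m) \<and> R m a \<subseteq> U}"
    have "K \<subseteq> (SIGMA m:UNIV. patterns (cube m))"
      by (auto simp: K_def)
    moreover have "countable (SIGMA m:(UNIV :: nat set). (patterns (cube m) :: (int ^ 'd \<Rightarrow> 'a) set))"
      by (rule countable_SIGMA[OF countableI_type countable_finite[OF finite_patterns[OF finite_cube]]])
    ultimately have "countable K"
      by (rule countable_subset)
    have "U \<subseteq> (\<Union>(m, a)\<in>K. R m a)"
    proof
      fix x assume "x \<in> U"
      have "openin (product_topology (\<lambda>_. euclidean) UNIV) U"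
        using that by (simp add: euclidean_product_topology)
      from product_topology_open_contains_basis[OF this \<open>x \<in> U\<close>]
      obtain X where X: "x \<in> (\<Pi>\<^sub>E i\<in>UNIV. X i)" "finite {i. X i \<noteq> UNIV}" "(\<Pi>\<^sub>E i\<in>UNIV. X i) \<subseteq> U"
        by auto
      \<comment> \<open>A basic neighbourhood of \<open>x\<close> restricts only finitely many
        coordinates. Once a cube covers these, the cylinder of \<open>x\<close> over that cube lies
        inside the neighbourhood.\<close>
      obtain m where m: "{i. X i \<noteq> UNIV} \<subseteq> cube m"
        using finite_subset_cube[OF X(2)] by blast
      have "R m (restrict x (cube m)) \<subseteq> (\<Pi>\<^sub>E i\<in>UNIV. X i)"
      proof
        fix y assume "y \<in> R m (restrict x (cube m))"
        then have y: "y i = x i" if "i \<in> cube m" for i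
          using that unfolding R_def by (auto dest: fun_cong[of _ _ i])
        have "y i \<in> X i" for i
          using m y[of i] X(1) by (cases "i \<in> cube m") (auto simp: PiE_iff)
        then show "y \<in> (\<Pi>\<^sub>E i\<in>UNIV. X i)"
          by auto
      qed
      then have "(m, restrict x (cube m)) \<in> K"
        using X(3) by (auto simp: K_def)
      then show "x \<in> (\<Union>(m, a)\<in>K. R m a)"
        by (force simp: R_def)
    qed
    then have "U = (\<Union>(m, a)\<in>K. R m a)"
      by (auto simp: K_def)
    moreover have "(\<Union>(m, a)\<in>K. R m a) \<in> sigma_sets UNIV local_events"
    proof (intro sigma_sets_UNION)
      show "countable ((\<lambda>(m, a). R m a) ` K)"
        using \<open>countable K\<close> by simp
      show "B \<in> sigma_sets UNIV local_events" if "B \<in> (\<lambda>(m, a). R m a) ` K" for B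
        using that by (auto simp: R_def intro!: sigma_sets.Basic restrict_eq_local_event finite_cube)
    qed
    ultimately show ?thesis
      by simp
  qed
  then show "sets (borel :: (int ^ 'd \<Rightarrow> 'a) measure) \<subseteq> sigma_sets UNIV local_events"
    unfolding borel_def by (auto intro!: sigma_sets_mono)
qed

lemma compact_configurations: "compact (UNIV :: (int ^ 'd \<Rightarrow> 'a::{finite, discrete_topology}) set)"
proof -
  have "compactin (product_topology (\<lambda>i::int ^ 'd. euclidean :: 'a topology) UNIV) (PiE UNIV (\<lambda>_. UNIV))"
    by (subst compactin_PiE) (auto intro: finite_imp_compact)
  then show ?thesis
    by (simp add: euclidean_product_topology)
qed

section \<open>From finite additivity to a Borel measure\<close>

text \<open>Local events are closed subsets of a compact space, so a decreasing sequence of them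
  with empty intersection is empty from some index on. Continuity at the empty set, the hypothesis
  of Caratheodory's theorem, thus follows from finite additivity. The measure agrees with
  \<open>g\<close> on local events; on other sets \<open>g\<close> may differ from it.\<close>

lemma finitely_additive_local_extension:
  fixes g :: "(int ^ 'd \<Rightarrow> 'a::{finite, discrete_topology}) set \<Rightarrow> real"
  assumes nonneg: "\<And>A. 0 \<le> g A"
    and add: "\<And>A B. A \<inter> B = {} \<Longrightarrow> g (A \<union> B) = g A + g B"
    and one: "g UNIV = 1"
  shows "\<exists>M. prob_space M \<and> sets M = sets borel \<and> (\<forall>A\<in>local_events. measure M A = g A)"
proof -
  interpret algebra UNIV "local_events :: (int ^ 'd \<Rightarrow> 'a) set set"
    by (rule algebra_local_events)
  have g0: "g {} = 0"
    using add[of "{}" "{}"] by simp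
  have "\<exists>\<mu> :: (int ^ 'd \<Rightarrow> 'a) set \<Rightarrow> ennreal. (\<forall>s\<in>local_events. \<mu> s = ennreal (g s)) \<and>
      measure_space UNIV (sigma_sets UNIV local_events) \<mu>"
  proof (rule caratheodory_empty_continuous)
    show "positive local_events (\<lambda>s. ennreal (g s))"
      by (simp add: positive_def g0)
    show "additive local_events (\<lambda>s. ennreal (g s))"
      by (simp add: additive_def add nonneg)
    fix A :: "nat \<Rightarrow> (int ^ 'd \<Rightarrow> 'a) set"
    assume A: "range A \<subseteq> local_events" "decseq A" "(\<Inter>i. A i) = {}"
    have "\<exists>i. A i = {}"
    proof (rule ccontr)
      assume ne: "\<nexists>i. A i = {}"
      have "UNIV \<inter> (\<Inter>i\<in>UNIV. A i) \<noteq> {}"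
      proof (rule compact_imp_fip_image[OF compact_configurations])
        show "closed (A i)" for i
          using A(1) by (auto intro: local_events_closed)
        fix I' :: "nat set" assume "finite I'"
        \<comment> \<open>A decreasing sequence has its finite intersections bounded below by the
          member of largest index. The inserted \<open>0\<close> gives the maximum a value when
          \<open>I'\<close> is empty.\<close>
        then have "A (Max (insert 0 I')) \<subseteq> (\<Inter>i\<in>I'. A i)"
          by (intro INT_greatest decseqD[OF A(2)] Max_ge) auto
        then show "UNIV \<inter> (\<Inter>i\<in>I'. A i) \<noteq> {}"
          using ne by auto
      qed
      then show False
        using A(3) by simp
    qed
    then obtain i where i: "A i = {}" ..
    have "eventually (\<lambda>j. ennreal (g (A j)) = 0) sequentially"
      using eventually_ge_at_top[of i]
    proof eventually_elim
      case (elim j)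
      then have "A j = {}"
        using A(2) i by (auto simp: decseq_def)
      then show ?case
        by (simp add: g0)
    qed
    then show "(\<lambda>i. ennreal (g (A i))) \<longlonglongrightarrow> 0"
      by (rule tendsto_eventually)
  qed simp
  then obtain \<mu> :: "(int ^ 'd \<Rightarrow> 'a) set \<Rightarrow> ennreal"
    where \<mu>: "\<And>s. s \<in> local_events \<Longrightarrow> \<mu> s = ennreal (g s)"
      and ms: "measure_space UNIV (sigma_sets UNIV local_events) \<mu>"
    by blast
  define M where "M = measure_of UNIV local_events \<mu>"
  have sets: "sets M = sets borel"
    by (simp add: M_def sets_measure_of sigma_sets_local_events)
  have em: "emeasure M A = ennreal (g A)" if "A \<in> local_events" for A
  proof -
    have "emeasure M A = \<mu> A"
      using ms that by (simp add: M_def emeasure_measure_of_conv sigma_sets.Basic)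
    then show ?thesis
      using \<mu>[OF that] by simp
  qed
  show ?thesis
  proof (intro exI conjI ballI)
    show "prob_space M"
    proof
      have "space M = UNIV"
        by (simp add: M_def space_measure_of)
      then show "emeasure M (space M) = 1"
        using em[OF top] by (simp add: one)
    qed
    show "measure M A = g A" if "A \<in> local_events" for A
      using em[OF that] nonneg[of A] by (simp add: measure_def)
  qed (rule sets)
qed

section \<open>Marginals on cubes\<close>

lemma sets_eq_borel_imp_space: "sets M = sets (borel :: 'a::topological_space measure) \<Longrightarrow> space M = UNIV"
  using sets_eq_imp_space_eq[of M borel] by simp

lemma restrict_measurable_invariant:
  fixes M :: "(int ^ 'd \<Rightarrow> 'a::{finite, discrete_topology}) measure"
  assumes "sets M = sets borel"
  shows "(\<lambda>x. restrict x (cube k)) \<in> M \<rightarrow>\<^sub>M count_space (patterns (cube k))"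
  using restrict_measurable measurable_cong_sets[OF assms refl] by blast

lemma restrict_measurable_patterns:
  assumes "sets M = sets (count_space (patterns (cube k)))"
  shows "(\<lambda>x. restrict x (cube n)) \<in> M \<rightarrow>\<^sub>M count_space (patterns (cube n))"
  by (subst measurable_cong_sets[OF assms refl]) simp

lemma restrict_restrict_subset: "E \<subseteq> F \<Longrightarrow> restrict (restrict x F) E = restrict x E"
  by (simp add: Int_absorb1)

lemma measure_marginal_borel:
  fixes M :: "(int ^ 'd \<Rightarrow> 'a::{finite, discrete_topology}) measure"
  assumes "sets M = sets borel" "B \<subseteq> patterns (cube k)"
  shows "measure (marginal k M) B = measure M {x. restrict x (cube k) \<in> B}"
  using assms restrict_measurable_invariant[OF assms(1), of k] sets_eq_borel_imp_space[OF assms(1)]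
  by (simp add: marginal_def measure_distr vimage_def)

text \<open>The underlying space is now the finite set of patterns on \<open>cube k\<close>, so the
  preimage has to be cut down to it. The right-hand side has the form of the set functions used in
  the limit argument.\<close>

lemma measure_marginal_patterns:
  assumes "sets M = sets (count_space (patterns (cube k)))" "B \<subseteq> patterns (cube n)"
  shows "measure (marginal n M) B = measure M ({x. restrict x (cube n) \<in> B} \<inter> patterns (cube k))"
  using assms restrict_measurable_patterns[OF assms(1), of n] sets_eq_imp_space_eq[OF assms(1)]
  by (simp add: marginal_def measure_distr vimage_def)

lemma marginal_marginal:
  fixes M :: "(int ^ 'd \<Rightarrow> 'a::{finite, discrete_topology}) measure"
  assumes "sets M = sets borel" "n \<le> k"
  shows "marginal n (marginal k M) = marginal n M"
  unfolding marginal_def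
  by (subst distr_distr[OF _ restrict_measurable_invariant[OF assms(1)]])
    (auto simp: o_def restrict_restrict_subset[OF cube_mono[OF assms(2)]] simp del: restrict_restrict)

section \<open>Translated patterns and local invariance\<close>

text \<open>This links the two notions of invariance: a condition on a translated pattern becomes
  the preimage, under a shift of configurations, of a condition on the original pattern.\<close>

lemma restrict_translate_eq_shift_iff:
  assumes "a \<in> patterns E"
  shows "restrict x (translate E u) = shift u a \<longleftrightarrow> restrict (shift (- u) x) E = a"
proof
  have dom: "v \<in> translate E u \<longleftrightarrow> u + v \<in> E" for v
    by (force simp: translate_def image_iff algebra_simps)
  \<comment> \<open>Off their domains both patterns and restrictions take the value
    \<open>undefined\<close>, so the equalities of total functions below hold at those sites
    too.\<close>
  have ext: "a v = undefined" if "v \<notin> E" for v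
    using assms that by (auto simp: patterns_def PiE_iff extensional_def)
  show "restrict (shift (- u) x) E = a" if *: "restrict x (translate E u) = shift u a"
  proof
    fix v
    show "restrict (shift (- u) x) E v = a v"
      using fun_cong[OF *, of "v - u"] ext[of v] by (auto simp: dom shift_def)
  qed
  show "restrict x (translate E u) = shift u a" if *: "restrict (shift (- u) x) E = a"
  proof
    fix v
    show "restrict x (translate E u) v = shift u a v"
      using fun_cong[OF *, of "u + v"] ext[of "u + v"] by (auto simp: dom shift_def)
  qed
qed

lemma measure_shift_vimage:
  fixes M :: "(int ^ 'd \<Rightarrow> 'a::{finite, discrete_topology}) measure"
  assumes "M \<in> invariant_measures" "A \<in> sets borel"
  shows "measure M (shift u -` A) = measure M A"
proof -
  have s: "sets M = sets borel" and d: "distr M borel (shift u) = M"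
    using assms(1) by (auto simp: invariant_measures_def)
  have "shift u \<in> M \<rightarrow>\<^sub>M borel"
    using shift_measurable measurable_cong_sets[OF s refl] by blast
  then have "measure (distr M borel (shift u)) A = measure M (shift u -` A)"
    using assms(2) sets_eq_borel_imp_space[OF s] by (simp add: measure_distr)
  then show ?thesis
    by (simp add: d)
qed

text \<open>Under the marginal, a cylinder over \<open>E\<close> has the \<open>M\<close>-measure of
  an event on full configurations in which \<open>k\<close> no longer appears. Replacing the pattern
  by its translate pulls this event back along a shift, which preserves \<open>M\<close>.\<close>

lemma marginal_locally_invariant:
  fixes M :: "(int ^ 'd \<Rightarrow> 'a::{finite, discrete_topology}) measure"
  assumes "M \<in> invariant_measures"
  shows "marginal k M \<in> locally_invariant_measures k"
proof -
  have s: "sets M = sets borel" and p: "prob_space M"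
    using assms by (auto simp: invariant_measures_def)
  have cyl: "measure (marginal k M) (cylinder k E a) = measure M {x. restrict x E = a}"
    if "E \<subseteq> cube k" for E and a :: "int ^ 'd \<Rightarrow> 'a"
    using that s
    by (subst measure_marginal_borel)
      (auto simp: cylinder_def restrict_restrict_subset simp del: restrict_restrict)
  have "prob_space (marginal k M)"
    unfolding marginal_def by (intro prob_space.prob_space_distr p restrict_measurable_invariant s)
  then have "marginal k M \<in> prob_measures k"
    by (simp add: prob_measures_def marginal_def)
  moreover have "measure (marginal k M) (cylinder k E a) =
      measure (marginal k M) (cylinder k (translate E u) (shift u a))"
    if E: "E \<subseteq> cube k" "a \<in> patterns E" "translate E u \<subseteq> cube k" for E a u
  proof -
    have "{x. restrict x E = a} \<in> sets borel"
      by (intro borel_open local_events_open restrict_eq_local_event finite_subset[OF E(1)] finite_cube)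
    then have "measure M {x. restrict x E = a} = measure M (shift (- u) -` {x. restrict x E = a})"
      using measure_shift_vimage[OF assms] by metis
    also have "shift (- u) -` {x. restrict x E = a} = {x. restrict x (translate E u) = shift u a}"
      by (auto simp: restrict_translate_eq_shift_iff[OF E(2)])
    finally show ?thesis
      using E by (simp only: cyl)
  qed
  ultimately show ?thesis
    by (auto simp: locally_invariant_measures_def)
qed

text \<open>Local invariance compares single cylinders. An event read off from \<open>cube m\<close>
  is a finite disjoint union of cylinders over that cube, so the equality follows by summation. The
  two inclusions ensure that both the window and its translate fit into
  \<open>cube k\<close>.\<close>

lemma locally_invariant_shift_vimage:
  fixes M :: "(int ^ 'd \<Rightarrow> 'a::finite) measure"
  assumes M: "M \<in> locally_invariant_measures k"
    and A: "\<And>x y. \<forall>v\<in>cube m. x v = y v \<Longrightarrow> x \<in> A \<longleftrightarrow> y \<in> A"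
    and sub: "cube m \<subseteq> (cube k :: (int ^ 'd) set)" "translate (cube m) (- u) \<subseteq> cube k"
  shows "measure M (shift u -` A \<inter> patterns (cube k)) = measure M (A \<inter> patterns (cube k))"
proof -
  have p: "prob_space M" and s: "sets M = Pow (patterns (cube k))"
    and inv: "\<And>a. a \<in> patterns (cube m) \<Longrightarrow> measure M (cylinder k (cube m) a) =
      measure M (cylinder k (translate (cube m) (- u)) (shift (- u) a))"
    using M sub by (auto simp: locally_invariant_measures_def prob_measures_def)
  interpret prob_space M by fact
  \<comment> \<open>A pattern, being \<open>undefined\<close> off its cube, is itself a
    configuration, so its membership in \<open>A\<close> can be tested directly; the values off
    \<open>cube m\<close> do not affect the answer.\<close>
  define D where "D = patterns (cube m) \<inter> A"
  have "finite D"
    by (simp add: D_def finite_patterns finite_cube)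
  have D: "restrict x (cube m) \<in> D \<longleftrightarrow> x \<in> A" for x
    using A[of x "restrict x (cube m)"] by (simp add: D_def)
  have cyl: "cylinder k (translate (cube m) (- u)) (shift (- u) a) =
      {x. restrict (shift u x) (cube m) = a} \<inter> patterns (cube k)" if "a \<in> D" for a
    using that restrict_translate_eq_shift_iff[of a "cube m" _ "- u"]
    by (auto simp: cylinder_def D_def)
  have "A \<inter> patterns (cube k) = (\<Union>a\<in>D. cylinder k (cube m) a)"
    using D by (auto simp: cylinder_def)
  also have "measure M \<dots> = (\<Sum>a\<in>D. measure M (cylinder k (cube m) a))"
    using \<open>finite D\<close>
    by (intro finite_measure_finite_Union) (auto simp: s cylinder_def disjoint_family_on_def)
  also have "\<dots> = (\<Sum>a\<in>D. measure M (cylinder k (translate (cube m) (- u)) (shift (- u) a)))"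
    by (intro sum.cong inv) (auto simp: D_def)
  also have "\<dots> = measure M (\<Union>a\<in>D. cylinder k (translate (cube m) (- u)) (shift (- u) a))"
    using \<open>finite D\<close>
    by (intro finite_measure_finite_Union[symmetric]) (auto simp: s cyl disjoint_family_on_def)
  also have "(\<Union>a\<in>D. cylinder k (translate (cube m) (- u)) (shift (- u) a)) =
      shift u -` A \<inter> patterns (cube k)"
    using D by (auto simp: cyl)
  finally show ?thesis ..
qed

section \<open>The invariant limit measure\<close>

text \<open>Local events form an intersection-stable generator of the Borel sets, so two finite
  measures that agree on them coincide.\<close>

lemma invariant_measureI:
  fixes M :: "(int ^ 'd \<Rightarrow> 'a::{finite, discrete_topology}) measure"
  assumes p: "prob_space M" and s: "sets M = sets borel"
    and inv: "\<And>u A. A \<in> local_events \<Longrightarrow> measure M (shift u -` A) = measure M A"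
  shows "M \<in> invariant_measures"
proof -
  interpret prob_space M by fact
  interpret L: algebra UNIV "local_events :: (int ^ 'd \<Rightarrow> 'a) set set"
    by (rule algebra_local_events)
  have sp: "space M = UNIV"
    using s by (rule sets_eq_borel_imp_space)
  have "distr M borel (shift u) = M" for u
  proof (rule measure_eqI_generator_eq)
    have sm: "shift u \<in> M \<rightarrow>\<^sub>M borel"
      using shift_measurable measurable_cong_sets[OF s refl] by blast
    show "Int_stable (local_events :: (int ^ 'd \<Rightarrow> 'a) set set)"
      by (auto simp: Int_stable_def)
    show "emeasure (distr M borel (shift u)) A = emeasure M A" if "A \<in> local_events" for A
      using that borel_open[OF local_events_open[OF that]]
      by (simp add: emeasure_distr[OF sm] sp emeasure_eq_measure inv)
    show "emeasure (distr M borel (shift u)) UNIV \<noteq> \<infinity>"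
      using emeasure_distr[OF sm, of UNIV] by (simp add: emeasure_eq_measure)
  qed (auto simp: s sigma_sets_local_events)
  then show ?thesis
    using p s by (simp add: invariant_measures_def)
qed

text \<open>The offset \<open>k + n\<close> makes every window contain \<open>cube n\<close>, while
  the windows still exhaust the lattice. The measures \<open>\<nu> k\<close> may be mutually
  incompatible outside \<open>cube n\<close>; passing to a cluster point produces one consistent
  object.\<close>

lemma exists_invariant_extension:
  fixes \<nu> :: "nat \<Rightarrow> (int ^ 'd \<Rightarrow> 'a::{finite, discrete_topology}) measure"
  assumes loc: "\<And>k. \<nu> k \<in> locally_invariant_measures (k + n)"
    and marg: "\<And>k. marginal n (\<nu> k) = N"
  shows "\<exists>M\<in>invariant_measures. marginal n M = N"
proof -
  have p: "prob_space (\<nu> k)" and s: "sets (\<nu> k) = sets (count_space (patterns (cube (k + n))))" for k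
    using loc[of k] by (auto simp: locally_invariant_measures_def prob_measures_def)
  \<comment> \<open>All sets of patterns are measurable for \<open>\<nu> k\<close>, so
    \<open>f k\<close> is finitely additive on arbitrary sets of configurations. All
    \<open>f k\<close> therefore share one domain, whatever their windows.\<close>
  define f where "f k A = measure (\<nu> k) (A \<inter> patterns (cube (k + n)))" for k A
  have f01: "f k A \<in> {0..1}" for k A
    using prob_space.prob_le_1[OF p] by (simp add: f_def)
  obtain g where g: "\<And>C. closed C \<Longrightarrow> eventually (\<lambda>k. f k \<in> C) sequentially \<Longrightarrow> g \<in> C"
    using cluster_point_in_unit_cube[of f, OF f01] by metis
  note coord = continuous_on_product_coordinates[where 'b = real]
  \<comment> \<open>Evaluation at a set is continuous in the product topology. Equations and weak
    inequalities between finitely many values therefore define closed sets and pass to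
    \<open>g\<close>.\<close>
  have limit_eq: "g A = c" if "\<And>k. f k A = c" for A c
    using g[OF closed_Collect_eq[OF coord[of A] continuous_on_const[of _ c]]] that by simp
  have nonneg: "0 \<le> g A" for A
    using g[OF closed_Collect_le[OF continuous_on_const[of _ 0] coord[of A]]] f01 by simp
  have add: "g (A \<union> B) = g A + g B" if "A \<inter> B = {}" for A B
  proof -
    have "f k (A \<union> B) = f k A + f k B" for k
    proof -
      interpret prob_space "\<nu> k" by (rule p)
      show ?thesis
        unfolding f_def Int_Un_distrib2 using that
        by (intro finite_measure_Union) (auto simp: s)
    qed
    then show ?thesis
      using g[OF closed_Collect_eq[OF coord[of "A \<union> B"]
            continuous_on_add[OF coord[of A] coord[of B]]]] by simp
  qed
  have one: "g UNIV = 1"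
  proof (rule limit_eq)
    fix k
    show "f k UNIV = 1"
      using prob_space.prob_space[OF p[of k]] sets_eq_imp_space_eq[OF s[of k]] by (simp add: f_def)
  qed
  have inv: "g (shift u -` A) = g A" if A: "A \<in> local_events" for u A
  proof -
    obtain m where m: "\<And>x y. \<forall>v\<in>cube m. x v = y v \<Longrightarrow> x \<in> A \<longleftrightarrow> y \<in> A"
      using local_eventsD[OF A] by blast
    obtain r where r: "translate (cube m) (- u) \<subseteq> cube r"
      using finite_subset_cube[of "translate (cube m) (- u)"] by (auto simp: translate_def finite_cube)
    have "f k (shift u -` A) = f k A" if "k \<ge> max m r" for k
      unfolding f_def
    proof (rule locally_invariant_shift_vimage[OF loc m])
      show "cube m \<subseteq> cube (k + n)" "translate (cube m) (- u) \<subseteq> cube (k + n)"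
        using that r cube_mono[of m "k + n"] cube_mono[of r "k + n"] by auto
    qed
    \<comment> \<open>For small \<open>k\<close> the window of \<open>A\<close> or its translate may
      stick out of the cube, so the equality is available only from some index on; a cluster point
      depends only on tails.\<close>
    then have "eventually (\<lambda>k. f k (shift u -` A) = f k A) sequentially"
      by (rule eventually_sequentiallyI)
    then show ?thesis
      using g[OF closed_Collect_eq[OF coord[of "shift u -` A"] coord[of A]]] by simp
  qed
  obtain M where M: "prob_space M" "sets M = sets borel"
    "\<And>A. A \<in> local_events \<Longrightarrow> measure M A = g A"
    using finitely_additive_local_extension[of g, OF nonneg add one] by metis
  have "M \<in> invariant_measures"
    using M by (intro invariant_measureI) (auto simp: inv shift_vimage_local_events)
  moreover have "marginal n M = N"
  proof (rule measure_eqI_finite)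
    show "sets (marginal n M) = Pow (patterns (cube n))" "sets N = Pow (patterns (cube n))"
      using marg[of 0] by (auto simp: marginal_def)
    show "finite (patterns (cube n) :: (int ^ 'd \<Rightarrow> 'a) set)"
      by (intro finite_patterns finite_cube)
    fix a :: "int ^ 'd \<Rightarrow> 'a" assume a: "a \<in> patterns (cube n)"
    have N: "prob_space N"
      unfolding marg[of 0, symmetric] marginal_def
      by (intro prob_space.prob_space_distr p restrict_measurable_patterns[OF s])
    have M': "prob_space (marginal n M)"
      unfolding marginal_def
      by (intro prob_space.prob_space_distr M restrict_measurable_invariant)
    have "measure (marginal n M) {a} = g {x. restrict x (cube n) = a}"
      using a M by (simp add: measure_marginal_borel restrict_eq_local_event finite_cube)
    \<comment> \<open>Because all \<open>\<nu> k\<close> have the marginal \<open>N\<close>, the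
      value of \<open>f k\<close> at this event is constant in \<open>k\<close>, and
      \<open>g\<close> inherits it.\<close>
    also have "\<dots> = measure N {a}"
    proof (rule limit_eq)
      fix k
      show "f k {x. restrict x (cube n) = a} = measure N {a}"
        using measure_marginal_patterns[OF s, of "{a}" n k] a by (simp add: f_def marg)
    qed
    finally show "emeasure (marginal n M) {a} = emeasure N {a}"
      using N M' by (simp add: finite_measure.emeasure_eq_measure prob_space.finite_measure)
  qed
  ultimately show ?thesis ..
qed

section \<open>The two inclusions\<close>

theorem proposition4:
  fixes n :: nat
  shows "marginal n ` (invariant_measures :: (int ^ 'd \<Rightarrow> 'a::{finite, discrete_topology}) measure set)
    = (\<Inter>k\<in>{n..}. marginal n ` locally_invariant_measures k)"
proof (intro subset_antisym subsetI)
  fix N :: "(int ^ 'd \<Rightarrow> 'a) measure"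
  assume "N \<in> marginal n ` invariant_measures"
  then obtain M where M: "M \<in> invariant_measures" "N = marginal n M"
    by auto
  \<comment> \<open>The witness is the marginal of \<open>M\<close> on \<open>cube k\<close>, whose
    restriction to \<open>cube n\<close> is again \<open>N\<close>.\<close>
  have "N \<in> marginal n ` locally_invariant_measures k" if "n \<le> k" for k
    using M marginal_marginal[of M n k] marginal_locally_invariant[OF M(1), of k] that
    by (auto simp: invariant_measures_def intro!: image_eqI[of _ _ "marginal k M"])
  then show "N \<in> (\<Inter>k\<in>{n..}. marginal n ` locally_invariant_measures k)"
    by auto
next
  fix N :: "(int ^ 'd \<Rightarrow> 'a) measure"
  assume "N \<in> (\<Inter>k\<in>{n..}. marginal n ` locally_invariant_measures k)"
  then have "N \<in> marginal n ` locally_invariant_measures (k + n)" for k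
    by (rule INT_E[where a = "k + n"]) simp_all
  then have "\<forall>k. \<exists>\<mu>. \<mu> \<in> locally_invariant_measures (k + n) \<and> marginal n \<mu> = N"
    by (simp add: image_iff) metis
  then obtain \<nu> where "\<And>k. \<nu> k \<in> locally_invariant_measures (k + n)" "\<And>k. marginal n (\<nu> k) = N"
    by metis
  then show "N \<in> marginal n ` invariant_measures"
    using exists_invariant_extension[of \<nu> n N] by auto
qed

end
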